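(* Let $G=(V,E)$ be a graph that is bipartite or a split graph, and let $\overline{G}=(V,\binom{V}{2}\setminus E)$ denote its complement. Then \[ \operatorname{obs}_c(G)\leq |V|-1 \quad\text{and}\quad \operatorname{obs}_c(\overline{G}) \leq |V|-1 . \]
   Context: A geometric drawing of a graph represents its vertices by distinct points in the plane and each edge by the line segment between its endpoints. An obstacle is a polygon in the plane. An obstacle representation of a graph $G$ is a geometric drawing of $G$ together with a set $\mathcal{O}$ of obstacles such that two vertices of $G$ are adjacent if and only if the line segment between the corresponding points is disjoint from all obstacles in $\mathcal{O}$. The convex obstacle number $\operatorname{obs}_c(G)$ is the minimum number of obstacles in an obstacle representation of $G$ in which all obstacles are convex. A split graph is a graph whose vertex set can be partitioned into an independent set and a clique. *)

theory Defs
  imports "HOL-Analysis.Analysis" "HOL-Library.Ramsey" "HOL-Library.Extended_Nat"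
begin

definition simple_graph :: "'a set \<Rightarrow> 'a set set \<Rightarrow> bool" where
  "simple_graph V E \<longleftrightarrow> finite V \<and> E \<subseteq> [V]\<^bsup>2\<^esup>"

definition complement_edges :: "'a set \<Rightarrow> 'a set set \<Rightarrow> 'a set set" where
  "complement_edges V E = [V]\<^bsup>2\<^esup> - E"

(* As usual, the parts in the next two definitions may be empty. *)

definition bipartite_graph :: "'a set \<Rightarrow> 'a set set \<Rightarrow> bool" where
  "bipartite_graph V E \<longleftrightarrow> simple_graph V E \<and>
     (\<exists>A B. A \<union> B = V \<and> A \<inter> B = {} \<and> indep A E \<and> indep B E)"

definition split_graph :: "'a set \<Rightarrow> 'a set set \<Rightarrow> bool" where
  "split_graph V E \<longleftrightarrow> simple_graph V E \<and>
     (\<exists>A B. A \<union> B = V \<and> A \<inter> B = {} \<and> indep A E \<and> clique B E)"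

(* Each edge is drawn as the closed segment between the images of its endpoints,
   so a geometric drawing is determined by the placement of the vertices. *)
definition geometric_drawing :: "'a set \<Rightarrow> ('a \<Rightarrow> real^2) \<Rightarrow> bool" where
  "geometric_drawing V p \<longleftrightarrow> inj_on p V"

(* The closed region bounded by a convex polygon: the convex hull of finitely many
   points of the plane that are not all collinear. *)
definition convex_polygon :: "(real^2) set \<Rightarrow> bool" where
  "convex_polygon P \<longleftrightarrow> polytope P \<and> aff_dim P = 2"

definition obstacle_representation ::
    "'a set \<Rightarrow> 'a set set \<Rightarrow> ('a \<Rightarrow> real^2) \<Rightarrow> (real^2) set set \<Rightarrow> bool" where
  "obstacle_representation V E p Obs \<longleftrightarrow> geometric_drawing V p \<and>
     (\<forall>u\<in>V. \<forall>v\<in>V. u \<noteq> v \<longrightarrow>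
        ({u, v} \<in> E \<longleftrightarrow> (\<forall>P\<in>Obs. disjnt (closed_segment (p u) (p v)) P)))"

(* The value is infinite if there is no representation with finitely many convex obstacles;
   otherwise the infimum is attained, so it is the minimum. *)
definition convex_obstacle_number :: "'a set \<Rightarrow> 'a set set \<Rightarrow> enat" where
  "convex_obstacle_number V E = Inf {enat (card Obs) | p Obs.
     finite Obs \<and> (\<forall>P\<in>Obs. convex_polygon P) \<and> obstacle_representation V E p Obs}"

end

theory Submission
  imports Defs
begin

text \<open>
  In the graph and in its complement, each of the parts \<open>A\<close>, \<open>B\<close> is independent or a clique; the edges
  between the parts are arbitrary. Enumerate both parts and place the \<open>i\<close>-th vertex of \<open>A\<close> at \<open>(0, h i)\<close>
  and the \<open>j\<close>-th vertex of \<open>B\<close> at \<open>(1, h j)\<close>, where \<open>h s = M s + s\<^sup>2\<close> with \<open>M\<close> large. The segments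
  of a fixed level \<open>i + j = k\<close> are then tangent to a common parabola, and distinct levels are
  well separated near \<open>x = 1/2\<close>. So the convex hull of the points of tangency of the nonedges of
  one level is an obstacle blocking exactly these nonedges; there are at most \<open>|V| - 1\<close> levels.

  Bending the two vertical lines slightly into parabolas, convex towards each other, pushes
  the chords inside a part to the outer side, where one further obstacle (the hull of the midpoints
  of the chords) blocks all of them. This costs one obstacle for each independent part, which is
  paid for by choosing the enumerations such that the lowest level (and for two independent
  parts also the highest one) consists of a single edge. If this is impossible, then there are no edges
  between the parts, or these edges form a star and its centre is a one-vertex clique with
  independent complement.
\<close>

section \<open>Polygonal obstacles from finite point sets\<close>

text \<open>Obstacles have to be two-dimensional, but the hulls used later may be points or
  segments. By compactness there is a positive gap between \<open>F\<close> and the hull, which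
  leaves room for a slightly larger polygon.\<close>

lemma thicken_hull:
  fixes S F :: "(real^2) set"
  assumes "finite S" "S \<noteq> {}" "compact F" "disjnt F (convex hull S)"
  obtains P where "convex_polygon P" "convex hull S \<subseteq> P" "disjnt F P"
proof -
  obtain e where e: "e > 0" "\<And>x y. x \<in> F \<Longrightarrow> y \<in> convex hull S \<Longrightarrow> e \<le> dist x y"
    using separate_compact_closed[OF assms(3) compact_imp_closed[OF finite_imp_compact_convex_hull[OF assms(1)]]] assms(4)
    by (auto simp: disjnt_def)
  obtain s where s: "s \<in> S" using assms by blast
  \<comment> \<open>The two new points leave \<open>s\<close> in independent directions, which
    forces dimension 2. Their distance \<open>e/2\<close> from \<open>s\<close> keeps them in
    \<open>Q\<close>, the open \<open>e\<close>-neighbourhood of the hull, which is convex as a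
    Minkowski sum.\<close>
  define P where "P = convex hull (S \<union> {s + (e/2) *\<^sub>R axis 1 1, s + (e/2) *\<^sub>R axis 2 1})"
  define Q where "Q = (\<Union>x\<in>convex hull S. \<Union>y\<in>ball 0 e. {x + y})"
  have "convex Q" unfolding Q_def by (intro convex_sums convex_convex_hull convex_ball)
  moreover have "S \<union> {s + (e/2) *\<^sub>R axis 1 1, s + (e/2) *\<^sub>R axis 2 1} \<subseteq> Q"
  proof -
    have "x + y \<in> Q" if "x \<in> S" "norm y < e" for x y
    proof -
      have "x \<in> convex hull S" "y \<in> ball 0 e" using that by (simp_all add: hull_inc)
      then show ?thesis unfolding Q_def by blast
    qed
    from this[of _ 0] this[OF s, of "(e/2) *\<^sub>R axis 1 1"] this[OF s, of "(e/2) *\<^sub>R axis 2 1"]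
    show ?thesis using e by (auto simp: norm_axis_1)
  qed
  ultimately have PQ: "P \<subseteq> Q" unfolding P_def by (rule hull_minimal[rotated])
  have "k + y \<notin> F" if "k \<in> convex hull S" "norm y < e" for k y
    using e(2)[of "k + y" k] that by (auto simp: dist_norm)
  then have "disjnt F Q" unfolding disjnt_iff Q_def by auto
  then have "disjnt F P" using PQ by (meson disjnt_subset2)
  moreover have "convex hull S \<subseteq> P" unfolding P_def by (intro hull_mono) auto
  moreover have "aff_dim P = 2"
  proof -
    let ?K = "{s, s + (e/2) *\<^sub>R axis 1 1, s + (e/2) *\<^sub>R axis 2 1} :: (real^2) set"
    have "independent {(e/2) *\<^sub>R axis 1 1, (e/2) *\<^sub>R axis 2 1 :: real^2}"
      using e by (intro pairwise_orthogonal_independent)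
        (auto simp: pairwise_def orthogonal_def inner_axis_axis axis_eq_0_iff)
    moreover have "(\<lambda>x. x - s) ` (?K - {s}) = {(e/2) *\<^sub>R axis 1 1, (e/2) *\<^sub>R axis 2 1}"
      using e by (auto simp: axis_eq_0_iff)
    ultimately have "\<not> affine_dependent ?K"
      by (subst affine_dependent_iff_dependent2[of s]) (auto simp: insert_commute)
    then have "aff_dim ?K = int (card ?K) - 1" using affine_independent_iff_card by blast
    also have "card ?K = 3" using e by (simp add: axis_eq_0_iff axis_eq_axis)
    finally have "aff_dim ?K = 2" by simp
    moreover have "aff_dim ?K \<le> aff_dim P"
      unfolding P_def aff_dim_convex_hull using s by (intro aff_dim_subset) auto
    moreover have "aff_dim P \<le> 2" using aff_dim_le_DIM[of P] by simp
    ultimately show ?thesis by linarith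
  qed
  moreover have "polytope P" unfolding P_def using assms(1) by (intro polytope_convex_hull) auto
  ultimately show ?thesis by (intro that[of P]) (simp_all add: convex_polygon_def)
qed

text \<open>This reduces the construction to finite point sets. The union of all drawn edges is
  compact, so each hull can be thickened without reaching any edge; blocked nonedges stay blocked
  because obstacles only grow.\<close>

lemma convex_obstacle_number_le:
  fixes V :: "'a set" and p :: "'a \<Rightarrow> real^2"
  assumes "finite V" and p: "inj_on p V"
    and fin: "finite \<S>" "\<And>S. S \<in> \<S> \<Longrightarrow> finite S \<and> S \<noteq> {}"
    and edge: "\<And>u v S. \<lbrakk>u \<in> V; v \<in> V; u \<noteq> v; {u, v} \<in> E; S \<in> \<S>\<rbrakk>
                 \<Longrightarrow> disjnt (closed_segment (p u) (p v)) (convex hull S)"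
    and nonedge: "\<And>u v. \<lbrakk>u \<in> V; v \<in> V; u \<noteq> v; {u, v} \<notin> E\<rbrakk>
                 \<Longrightarrow> \<exists>S\<in>\<S>. \<not> disjnt (closed_segment (p u) (p v)) (convex hull S)"
  shows "convex_obstacle_number V E \<le> enat (card \<S>)"
proof -
  define F where "F = (\<Union>(u, v)\<in>{(u, v)\<in>V \<times> V. u \<noteq> v \<and> {u, v} \<in> E}. closed_segment (p u) (p v))"
  have "compact F" unfolding F_def
    using assms(1) by (intro compact_UN) (auto intro: finite_subset[of _ "V \<times> V"])
  have "\<exists>P. convex_polygon P \<and> convex hull S \<subseteq> P \<and> disjnt F P" if "S \<in> \<S>" for S
  proof -
    have "disjnt F (convex hull S)"
      using edge that unfolding F_def disjnt_iff by blast
    then show ?thesis using fin(2)[OF that] thicken_hull[OF _ _ \<open>compact F\<close>, of S] by metis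
  qed
  then obtain P where P: "\<And>S. S \<in> \<S> \<Longrightarrow> convex_polygon (P S) \<and> convex hull S \<subseteq> P S \<and> disjnt F (P S)"
    by metis
  have "obstacle_representation V E p (P ` \<S>)"
    unfolding obstacle_representation_def geometric_drawing_def
  proof (intro conjI p ballI impI iffI)
    fix u v Q assume "u \<in> V" "v \<in> V" "u \<noteq> v" "{u, v} \<in> E" "Q \<in> P ` \<S>"
    then have "closed_segment (p u) (p v) \<subseteq> F" "disjnt F Q"
      using P unfolding F_def by auto
    then show "disjnt (closed_segment (p u) (p v)) Q" by (meson disjnt_subset1)
  next
    fix u v assume uv: "u \<in> V" "v \<in> V" "u \<noteq> v"
      "\<forall>Q\<in>P ` \<S>. disjnt (closed_segment (p u) (p v)) Q"
    show "{u, v} \<in> E"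
    proof (rule ccontr)
      assume "{u, v} \<notin> E"
      then obtain S where "S \<in> \<S>" "\<not> disjnt (closed_segment (p u) (p v)) (convex hull S)"
        using nonedge uv by blast
      then show False using uv(4) P by (meson disjnt_subset2 imageI)
    qed
  qed
  then have "convex_obstacle_number V E \<le> enat (card (P ` \<S>))"
    unfolding convex_obstacle_number_def using fin(1) P by (intro Inf_lower) blast
  also have "\<dots> \<le> enat (card \<S>)" using fin(1) by (simp add: card_image_le)
  finally show ?thesis .
qed

lemma disjnt_segment_hull:
  fixes w :: "'a::euclidean_space"
  assumes "w \<bullet> u \<le> c" "w \<bullet> v \<le> c" "\<And>s. s \<in> S \<Longrightarrow> w \<bullet> s > c"
  shows "disjnt (closed_segment u v) (convex hull S)"
proof -
  have "closed_segment u v \<subseteq> {x. w \<bullet> x \<le> c}"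
    using assms by (intro closed_segment_subset convex_halfspace_le) auto
  moreover have "convex hull S \<subseteq> {x. w \<bullet> x > c}"
    using assms by (intro hull_minimal convex_halfspace_gt) auto
  ultimately show ?thesis unfolding disjnt_iff by fastforce
qed

section \<open>Tangency points relative to the lines of other segments\<close>

text \<open>
  Up to the positive factor \<open>2 M + 2 a + 2 b\<close>, \<open>D\<close> is the height of the tangency point of the
  segment \<open>(a, b)\<close> above the line of the segment \<open>(i, j)\<close>: this point divides its segment
  in the ratio \<open>M + 2 a : M + 2 b\<close>.
\<close>

lemma level_sign:
  fixes a b i j N :: nat and M :: real
  defines "h \<equiv> \<lambda>s::nat. M * s + (real s)^2"
  defines "D \<equiv> (M + 2*b) * (h a - h i) + (M + 2*a) * (h b - h j)"
  assumes "a \<le> N" "b \<le> N" "i \<le> N" "j \<le> N" and M: "M = 32 * (real N + 1)^2"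
  shows "i + j < a + b \<Longrightarrow> D > 0"
    and "a + b \<le> i + j \<Longrightarrow> (a, b) \<noteq> (i, j) \<Longrightarrow> D < 0"
proof -
  \<comment> \<open>Since \<open>h a - h i = (a - i) * (M + a + i)\<close>, the leading term of
    \<open>D\<close> is \<open>M^2\<close> times the level difference, which is an integer.
    \<open>?e1\<close> and \<open>?e2\<close> collect the terms of degree at most one in
    \<open>M\<close>.\<close>
  let ?e1 = "(real a - i) * (M * (2*b + a + i) + 2*b*(real a + i))"
  let ?e2 = "(real b - j) * (M * (2*a + b + j) + 2*a*(real b + j))"
  have D: "D = M^2 * ((real a + b) - (real i + j)) + ?e1 + ?e2"
    unfolding D_def h_def by (simp add: algebra_simps power2_eq_square)
  have M0: "M > 0" unfolding M by simp
  have bd: "\<bar>(real x - y) * (M * (2*z + x + y) + 2*z*(real x + y))\<bar> \<le> N * (M * (4 * N) + 4*N*N)"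
    if "x \<le> N" "y \<le> N" "z \<le> N" for x y z :: nat
  proof -
    have "\<bar>real x - y\<bar> \<le> N" using that by linarith
    moreover have "M * (2*z + x + y) \<le> M * (4 * N)" using M0 that by (intro mult_left_mono) auto
    moreover have "real (2*z) * (real x + y) \<le> (2*real N) * (2*real N)" using that by (intro mult_mono) auto
    moreover have "0 \<le> M * (2*z + x + y) + 2*z*(real x + y)" using M0 by simp
    ultimately show ?thesis unfolding abs_mult by (intro mult_mono) auto
  qed
  have e: "\<bar>?e1\<bar> + \<bar>?e2\<bar> < M^2"
  proof -
    have "\<bar>?e1\<bar> + \<bar>?e2\<bar> \<le> 2 * (N * (M * (4 * N) + 4*N*N))"
      using bd[of a i b] bd[of b j a] assms by auto
    \<comment> \<open>The bound is \<open>16 * (N + 1)^2 * M\<close>; the constant 32 in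
      \<open>M\<close> turns this into \<open>M^2 / 2\<close>, less than one unit of level
      difference.\<close>
    also have "\<dots> \<le> 2 * (4 * ((real N + 1)^2 * M) + 4 * ((real N + 1)^2 * M))"
    proof -
      have "real N * N \<le> (real N + 1)^2" by (simp add: power2_eq_square algebra_simps)
      then have 1: "real N * N * M \<le> (real N + 1)^2 * M" using M0 by (intro mult_right_mono) auto
      have "real N \<le> M" unfolding M by (simp add: power2_eq_square algebra_simps)
      then have "real N * N * N \<le> real N * N * M" by (intro mult_left_mono) auto
      with 1 show ?thesis by (simp add: algebra_simps)
    qed
    also have "\<dots> = M * M / 2"
      using M by (simp add: algebra_simps)
    also have "\<dots> < M^2" using M0 by (simp add: power2_eq_square)
    finally show ?thesis .
  qed
  have big: "D > 0" if "i + j < a + b"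
  proof -
    have "M^2 * 1 \<le> M^2 * ((real a + b) - (real i + j))" using that by (intro mult_left_mono) auto
    then show ?thesis using D e by linarith
  qed
  then show "i + j < a + b \<Longrightarrow> D > 0" .
  show "D < 0" if "a + b \<le> i + j" "(a, b) \<noteq> (i, j)"
  proof (cases "a + b = i + j")
    \<comment> \<open>On a common level the estimate is useless because the leading term vanishes.
      The exact height is \<open>- r^2\<close>, the drop of the parabola below its tangent.\<close>
    case True
    define r where "r = real a - i"
    have ab: "real a = i + r" "real b = j - r" using True unfolding r_def by linarith+
    have "D = - (r^2 * (2*M + 2*a + 2*b))"
      unfolding D_def h_def of_nat_mult of_nat_numeral ab by (simp add: algebra_simps power2_eq_square)
    moreover have "r \<noteq> 0" using True that unfolding r_def by auto
    ultimately show ?thesis using M0 by simp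
  next
    case False
    then have "M^2 * ((real a + b) - (real i + j)) \<le> M^2 * (-1)" using that by (intro mult_left_mono) auto
    then show ?thesis using D e by linarith
  qed
qed

section \<open>The bent configuration in coordinates\<close>

definition pt :: "real \<Rightarrow> real \<Rightarrow> real^2" where "pt x y = vector [x, y]"

lemma pt_simps [simp]:
  "pt x y $ 1 = x" "pt x y $ 2 = y" "pt x y \<bullet> pt x' y' = x * x' + y * y'"
  "r *\<^sub>R pt x y = pt (r * x) (r * y)" "pt x y + pt x' y' = pt (x + x') (y + y')"
  "pt x y = pt x' y' \<longleftrightarrow> x = x' \<and> y = y'"
  by (auto simp: pt_def inner_vec_def vec_eq_iff sum_2 forall_2)

lemma eventually_affine_pos:
  fixes c d :: real
  assumes "c > 0"
  shows "eventually (\<lambda>x. c + x * d > 0) (at_right 0)"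
proof -
  have "((\<lambda>x. c + x * d) \<longlongrightarrow> c + 0 * d) (at_right 0)" by (intro tendsto_intros)
  then show ?thesis using assms by (intro order_tendstoD) auto
qed

lemma eventually_all_atMost:
  fixes N :: nat
  assumes "\<And>i. i \<le> N \<Longrightarrow> eventually (\<lambda>x. P i x) F"
  shows "eventually (\<lambda>x. \<forall>i\<le>N. P i x) F"
proof -
  have "eventually (\<lambda>x. \<forall>i\<in>{..N}. P i x) F"
    using assms by (intro eventually_ball_finite) auto
  then show ?thesis by (rule eventually_mono) auto
qed

text \<open>
  \<open>L\<close> and \<open>R\<close> place the vertices of the two parts, and \<open>T a b\<close> is the point at which an obstacle
  touches the segment from \<open>L a\<close> to \<open>R b\<close>.
\<close>

locale configuration =
  fixes N :: nat and L R :: "nat \<Rightarrow> real^2" and T :: "nat \<Rightarrow> nat \<Rightarrow> real^2"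
  assumes inj_L: "inj L" and inj_R: "inj R"
    and L_le: "L i $ 1 \<le> 0" and R_ge: "R j $ 1 \<ge> 1"
    and T_segment: "T a b \<in> closed_segment (L a) (R b)"
    and T_strip: "\<lbrakk>a \<le> N; b \<le> N\<rbrakk> \<Longrightarrow> 0 < T a b $ 1 \<and> T a b $ 1 < 1"
    and separate_T: "\<lbrakk>i \<le> N; j \<le> N\<rbrakk> \<Longrightarrow> \<exists>w c. w \<bullet> L i = c \<and> w \<bullet> R j = c \<and>
       (\<forall>a\<le>N. \<forall>b\<le>N. (i + j < a + b \<longrightarrow> w \<bullet> T a b > c) \<and>
          (a + b \<le> i + j \<longrightarrow> (a, b) \<noteq> (i, j) \<longrightarrow> w \<bullet> T a b < c))"
    and separate_L: "\<lbrakk>i \<le> N; j \<le> N\<rbrakk> \<Longrightarrow> \<exists>w c. w \<bullet> L i \<le> c \<and> w \<bullet> R j \<le> c \<and>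
       (\<forall>u v. u \<noteq> v \<longrightarrow> w \<bullet> midpoint (L u) (L v) > c)"
    and separate_R: "\<lbrakk>i \<le> N; j \<le> N\<rbrakk> \<Longrightarrow> \<exists>w c. w \<bullet> L i \<le> c \<and> w \<bullet> R j \<le> c \<and>
       (\<forall>u v. u \<noteq> v \<longrightarrow> w \<bullet> midpoint (R u) (R v) > c)"

text \<open>The strict inequalities needed hold for straight lines, where the bending
  \<open>x\<close> is 0, and each is affine in \<open>x\<close>. Indices up to \<open>N\<close> give
  only finitely many of them, so all survive some \<open>x > 0\<close>. Positive bending then makes
  both curves strictly convex, which separates the chords inside a part.\<close>

lemma ex_configuration: "\<exists>L R T. configuration N L R T"
proof -
  define M where "M = 32 * (real N + 1)^2"
  have M0: "M > 0" unfolding M_def by simp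
  define h where "h = (\<lambda>s::nat. M * s + (real s)^2)"
  have h0: "h s \<ge> 0" for s using M0 by (simp add: h_def)
  have h_inj: "h u = h v \<longleftrightarrow> u = v" for u v
  proof -
    have "h u - h v = (real u - v) * (M + u + v)"
      unfolding h_def by (simp add: algebra_simps power2_eq_square)
    moreover have "M + u + v > 0" using M0 by linarith
    ultimately show ?thesis by auto
  qed
  \<comment> \<open>\<open>D\<close> is the quantity of \<open>level_sign\<close> for the straight lines and \<open>D'\<close> its change
    per unit of bending \<open>x\<close>.\<close>
  define D where "D = (\<lambda>a b i j. (M + 2*real b) * (h a - h i) + (M + 2*real a) * (h b - h j))"
  define D' where "D' = (\<lambda>a b i j.
     (M + 2*real b) * ((h j - h i) * (h a ^ 2 - h i ^ 2) + (h i ^ 2 + h j ^ 2) * (h a - h i)) +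
     (M + 2*real a) * (- (h j - h i) * (h b ^ 2 - h j ^ 2) + (h i ^ 2 + h j ^ 2) * (h b - h j)))"
  \<comment> \<open>The third and fourth conditions keep the points \<open>T a b\<close> strictly
    between the lines at 0 and 1. The last one bounds the bending so that a tangent to one curve has
    the whole other part on its inner side.\<close>
  have ev: "eventually (\<lambda>x. \<forall>a\<le>N. \<forall>b\<le>N. \<forall>i\<le>N. \<forall>j\<le>N.
      (i + j < a + b \<longrightarrow> D a b i j + x * D' a b i j > 0) \<and>
      (a + b \<le> i + j \<longrightarrow> (a, b) \<noteq> (i, j) \<longrightarrow> D a b i j + x * D' a b i j < 0) \<and>
      (M + 2 * a) + x * ((M + 2*a) * h b ^ 2 - (M + 2*b) * h a ^ 2) > 0 \<and>
      (M + 2 * b) + x * ((M + 2*b) * h a ^ 2 - (M + 2*a) * h b ^ 2) > 0 \<and>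
      1 + x * (- (h a ^ 2)) > 0) (at_right 0)"
  proof (intro eventually_all_atMost eventually_conj)
    fix a b i j assume "a \<le> N" "b \<le> N" "i \<le> N" "j \<le> N"
    note sgn = level_sign[OF this M_def]
    show "\<forall>\<^sub>F x in at_right 0. i + j < a + b \<longrightarrow> D a b i j + x * D' a b i j > 0"
      using eventually_affine_pos[of "D a b i j" "D' a b i j"] sgn(1) 
      by (cases "i + j < a + b") (auto simp: D_def h_def)
    show "\<forall>\<^sub>F x in at_right 0. a + b \<le> i + j \<longrightarrow> (a, b) \<noteq> (i, j) \<longrightarrow> D a b i j + x * D' a b i j < 0"
    proof (cases "a + b \<le> i + j \<and> (a, b) \<noteq> (i, j)")
      case True
      then have "- D a b i j > 0" using sgn(2) by (auto simp: D_def h_def)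
      from eventually_affine_pos[OF this, of "- D' a b i j"] show ?thesis
        by eventually_elim auto
    qed auto
  qed (rule eventually_affine_pos, use M0 in \<open>simp add: add_pos_nonneg\<close>)+
  have "eventually (\<lambda>x. x > (0::real)) (at_right 0)" by (rule eventually_at_right_less)
  from eventually_happens[OF eventually_conj[OF this ev]] obtain x where x: "x > 0"
    and xx: "\<And>a b i j. \<lbrakk>a \<le> N; b \<le> N; i \<le> N; j \<le> N\<rbrakk> \<Longrightarrow>
      (i + j < a + b \<longrightarrow> D a b i j + x * D' a b i j > 0) \<and>
      (a + b \<le> i + j \<longrightarrow> (a, b) \<noteq> (i, j) \<longrightarrow> D a b i j + x * D' a b i j < 0) \<and>
      (M + 2 * a) + x * ((M + 2*a) * h b ^ 2 - (M + 2*b) * h a ^ 2) > 0 \<and>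
      (M + 2 * b) + x * ((M + 2*b) * h a ^ 2 - (M + 2*a) * h b ^ 2) > 0 \<and>
      1 + x * (- (h a ^ 2)) > 0"
    by auto
  define L where "L = (\<lambda>i. pt (- x * h i ^ 2) (h i))"
  define R where "R = (\<lambda>j. pt (1 + x * h j ^ 2) (h j))"
  define W where "W = (\<lambda>a b::nat. 2 * M + 2 * real a + 2 * real b)"
  \<comment> \<open>The weights are those of the unbent configuration. They no longer need to
    describe a tangency, but \<open>T a b\<close> remains on its segment and the strict inequalities
    are all that is used.\<close>
  define T where "T = (\<lambda>a b. ((M + 2*b) / W a b) *\<^sub>R L a + ((M + 2*a) / W a b) *\<^sub>R R b)"
  have W0: "W a b > 0" for a b unfolding W_def using M0 by linarith
  have W1: "(M + 2*b) / W a b = 1 - (M + 2*a) / W a b" for a b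
    using W0[of a b] by (simp add: W_def field_simps)
  have "configuration N L R T"
  proof
    show "inj L" "inj R" unfolding L_def R_def inj_def by (auto simp: h_inj)
    show "L i $ 1 \<le> 0" for i unfolding L_def using x by simp
    show "R j $ 1 \<ge> 1" for j unfolding R_def using x by simp
    show "T a b \<in> closed_segment (L a) (R b)" for a b
      unfolding in_segment using W0[of a b] M0
      by (intro exI[of _ "(M + 2*a) / W a b"]) (auto simp: T_def W1 W_def field_simps)
    show "0 < T a b $ 1 \<and> T a b $ 1 < 1" if "a \<le> N" "b \<le> N" for a b
    proof -
      let ?n = "(M + 2 * a) + x * ((M + 2*a) * h b ^ 2 - (M + 2*b) * h a ^ 2)"
      have "W a b - ?n = (M + 2 * b) + x * ((M + 2*b) * h a ^ 2 - (M + 2*a) * h b ^ 2)"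
        by (simp add: W_def algebra_simps)
      then have "0 < ?n" "?n < W a b" using xx[OF that that] by linarith+
      moreover have "T a b $ 1 = ?n / W a b"
        unfolding T_def L_def R_def using W0[of a b] by (simp add: field_simps)
      ultimately show ?thesis using W0[of a b] by simp
    qed
    show "\<exists>w c. w \<bullet> L i = c \<and> w \<bullet> R j = c \<and>
       (\<forall>a\<le>N. \<forall>b\<le>N. (i + j < a + b \<longrightarrow> w \<bullet> T a b > c) \<and>
          (a + b \<le> i + j \<longrightarrow> (a, b) \<noteq> (i, j) \<longrightarrow> w \<bullet> T a b < c))" if ij: "i \<le> N" "j \<le> N" for i j
    proof -
      \<comment> \<open>An upward normal of the line through \<open>L i\<close> and
        \<open>R j\<close>. Leaving it unnormalised keeps its products with \<open>L a\<close> and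
        \<open>R b\<close> affine in \<open>x\<close>.\<close>
      define w where "w = pt (- (h j - h i)) (1 + x * (h i ^ 2 + h j ^ 2))"
      have eq: "w \<bullet> R j = w \<bullet> L i"
        unfolding w_def R_def L_def by (simp add: algebra_simps power2_eq_square)
      have L': "w \<bullet> L a = w \<bullet> L i + ((h a - h i) + x * ((h j - h i) * (h a ^ 2 - h i ^ 2) + (h i ^ 2 + h j ^ 2) * (h a - h i)))" for a
        unfolding w_def L_def by (simp add: algebra_simps)
      have R': "w \<bullet> R b = w \<bullet> L i + ((h b - h j) + x * (- (h j - h i) * (h b ^ 2 - h j ^ 2) + (h i ^ 2 + h j ^ 2) * (h b - h j)))" for b
        unfolding eq[symmetric] unfolding w_def R_def by (simp add: algebra_simps)
      have T': "w \<bullet> T a b = w \<bullet> L i + (D a b i j + x * D' a b i j) / W a b" for a b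
      proof -
        have "w \<bullet> T a b = ((M + 2*b) * (w \<bullet> L a) + (M + 2*a) * (w \<bullet> R b)) / W a b"
          by (simp only: T_def inner_add_right inner_scaleR_right times_divide_eq_left
              of_nat_mult of_nat_numeral) (rule add_divide_distrib[symmetric])
        also have "(M + 2*b) * (w \<bullet> L a) + (M + 2*a) * (w \<bullet> R b) = W a b * (w \<bullet> L i) + (D a b i j + x * D' a b i j)"
          unfolding L'[of a] R'[of b] W_def D_def D'_def by (simp add: algebra_simps)
        finally show ?thesis using W0[of a b] by (simp add: add_divide_distrib)
      qed
      show ?thesis
        using xx[OF _ _ ij] W0 by (intro exI[of _ w] exI[of _ "w \<bullet> L i"]) (auto simp: eq T' divide_neg_pos)
    qed
    have conv: "u \<noteq> v \<Longrightarrow> 0 < x * (h u - h i)\<^sup>2 + x * (h v - h i)\<^sup>2" for u v i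
    proof -
      assume "u \<noteq> v"
      then have "h u - h i \<noteq> 0 \<or> h v - h i \<noteq> 0" by (auto simp: h_inj)
      then have "(h u - h i)\<^sup>2 + (h v - h i)\<^sup>2 > 0" by (simp add: sum_power2_gt_zero_iff)
      then show "0 < x * (h u - h i)\<^sup>2 + x * (h v - h i)\<^sup>2"
        unfolding distrib_left[symmetric] using x by (rule mult_pos_pos[rotated])
    qed
    show "\<exists>w c. w \<bullet> L i \<le> c \<and> w \<bullet> R j \<le> c \<and>
       (\<forall>u v. u \<noteq> v \<longrightarrow> w \<bullet> midpoint (L u) (L v) > c)" if ij: "i \<le> N" "j \<le> N" for i j
    proof -
      \<comment> \<open>Outer normal of the tangent to the left parabola at \<open>L i\<close>. The
        excess of \<open>L u\<close> over the tangent is a square, so the midpoint of two distinct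
        points lies strictly outside.\<close>
      let ?w = "pt (-1) (- 2 * x * h i)" and ?c = "- x * h i ^ 2"
      have L': "?w \<bullet> L u = ?c + x * (h u - h i)\<^sup>2" for u
        unfolding L_def by (simp add: algebra_simps power2_eq_square)
      have 1: "?w \<bullet> L i \<le> ?c" using L'[of i] by simp
      have "0 \<le> x * h i * h j" "0 \<le> x * h j ^ 2" using x h0 by simp_all
      moreover have "x * h i ^ 2 < 1" using xx[OF ij ij] by simp
      moreover have "?w \<bullet> R j = - 1 - x * h j ^ 2 - 2 * (x * h i * h j)"
        unfolding R_def by simp
      ultimately have 2: "?w \<bullet> R j \<le> ?c" by linarith
      have "?c < ?w \<bullet> midpoint (L u) (L v)" if "u \<noteq> v" for u v
        unfolding midpoint_def inner_scaleR_right inner_add_right L' using conv[OF that, of i] by simp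
      with 1 2 show ?thesis by (intro exI[of _ ?w] exI[of _ ?c] conjI allI impI)
    qed
    show "\<exists>w c. w \<bullet> L i \<le> c \<and> w \<bullet> R j \<le> c \<and>
       (\<forall>u v. u \<noteq> v \<longrightarrow> w \<bullet> midpoint (R u) (R v) > c)" if ij: "i \<le> N" "j \<le> N" for i j
    proof -
      \<comment> \<open>The mirror image: the tangent to the right parabola at
        \<open>R j\<close>.\<close>
      let ?w = "pt 1 (- 2 * x * h j)" and ?c = "1 - x * h j ^ 2"
      have R': "?w \<bullet> R u = ?c + x * (h u - h j)\<^sup>2" for u
        unfolding R_def by (simp add: algebra_simps power2_eq_square)
      have 1: "?w \<bullet> R j \<le> ?c" using R'[of j] by simp
      have "0 \<le> x * h i * h j" "0 \<le> x * h i ^ 2" using x h0 by simp_all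
      moreover have "x * h j ^ 2 < 1" using xx[OF ij(2,1) ij] by simp
      moreover have "?w \<bullet> L i = - x * h i ^ 2 - 2 * (x * h i * h j)"
        unfolding L_def by simp
      ultimately have 2: "?w \<bullet> L i \<le> ?c" by linarith
      have "?c < ?w \<bullet> midpoint (R u) (R v)" if "u \<noteq> v" for u v
        unfolding midpoint_def inner_scaleR_right inner_add_right R' using conv[OF that, of j] by simp
      with 1 2 show ?thesis by (intro exI[of _ ?w] exI[of _ ?c] conjI allI impI)
    qed
  qed
  then show ?thesis by blast
qed

section \<open>Obstacles for two parts with given enumerations\<close>

text \<open>
  Nonedges between the parts with the same value of \<open>l\<close> share an obstacle. If there are no edges
  between the parts, nothing forces \<open>l\<close> to be the level, and one obstacle suffices.
\<close>

lemma convex_obstacle_number_two_parts: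
  fixes A B :: "'a set" and f g :: "'a \<Rightarrow> nat" and l :: "'a \<Rightarrow> 'a \<Rightarrow> nat"
  assumes fin: "finite A" "finite B" and disj: "A \<inter> B = {}"
    and f: "inj_on f A" and g: "inj_on g B"
    and A: "indep A E \<or> clique A E" and B: "indep B E \<or> clique B E"
    and level: "\<And>a b i j. \<lbrakk>a \<in> A; b \<in> B; {a, b} \<in> E; i \<in> A; j \<in> B\<rbrakk> \<Longrightarrow> l i j = f i + g j"
  shows "convex_obstacle_number (A \<union> B) E \<le>
    enat (card {l a b | a b. a \<in> A \<and> b \<in> B \<and> {a, b} \<notin> E} +
          (if clique A E then 0 else 1) + (if clique B E then 0 else 1))"
proof -
  have "finite (f ` A \<union> g ` B)" using fin by simp
  then obtain N where "f ` A \<union> g ` B \<subseteq> {..N}" by (meson finite_nat_iff_bounded_le)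
  then have N: "\<And>a. a \<in> A \<Longrightarrow> f a \<le> N" "\<And>b. b \<in> B \<Longrightarrow> g b \<le> N" by auto
  obtain L R T where "configuration N L R T" using ex_configuration by blast
  then interpret configuration N L R T .
  define p where "p = (\<lambda>v. if v \<in> A then L (f v) else R (g v))"
  have pA: "p a = L (f a)" if "a \<in> A" for a using that by (simp add: p_def)
  have pB: "p b = R (g b)" if "b \<in> B" for b using that disj by (auto simp: p_def)
  have "p a \<noteq> p b" if "a \<in> A" "b \<in> B" for a b
    using L_le[of "f a"] R_ge[of "g b"] that by (auto simp: pA pB)
  then have p: "inj_on p (A \<union> B)"
    using f g inj_L inj_R by (auto simp: inj_on_def pA pB) metis
  define K where "K = {l a b | a b. a \<in> A \<and> b \<in> B \<and> {a, b} \<notin> E}"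
  define SK where "SK = (\<lambda>k. {T (f a) (g b) | a b. a \<in> A \<and> b \<in> B \<and> {a, b} \<notin> E \<and> l a b = k})"
  define mid where "mid = (\<lambda>X. {midpoint (p u) (p v) | u v. u \<in> X \<and> v \<in> X \<and> u \<noteq> v})"
  \<comment> \<open>A part that is not a clique is independent, so the single set \<open>mid\<close>
    may block all of its chords.\<close>
  define \<S> where "\<S> = SK ` K \<union> (if clique A E then {} else {mid A}) \<union> (if clique B E then {} else {mid B})"
  have "finite K" unfolding K_def
    by (rule finite_subset[of _ "(\<lambda>(a, b). l a b) ` (A \<times> B)"]) (use fin in auto)
  have S_cases: "(\<exists>k. S = SK k) \<or> (S = mid A \<and> \<not> clique A E) \<or> (S = mid B \<and> \<not> clique B E)" if "S \<in> \<S>" for S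
    using that by (auto simp: \<S>_def split: if_splits)
  have "convex_obstacle_number (A \<union> B) E \<le> enat (card \<S>)"
  proof (rule convex_obstacle_number_le[OF _ p])
    show "finite (A \<union> B)" using fin by simp
    show "finite \<S>" using \<open>finite K\<close> by (simp add: \<S>_def)
    show "finite S \<and> S \<noteq> {}" if "S \<in> \<S>" for S
    proof -
      have "finite (SK k)" for k unfolding SK_def
        by (rule finite_subset[of _ "(\<lambda>(a, b). T (f a) (g b)) ` (A \<times> B)"]) (use fin in auto)
      moreover have "SK k \<noteq> {}" if "k \<in> K" for k using that unfolding K_def SK_def by auto
      moreover have "finite (mid X)" if "finite X" for X unfolding mid_def
        by (rule finite_subset[of _ "(\<lambda>(a, b). midpoint (p a) (p b)) ` (X \<times> X)"]) (use that in auto)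
      moreover have "mid X \<noteq> {}" if "\<not> clique X E" for X
        using that unfolding mid_def clique_def by blast
      ultimately show ?thesis using that fin by (auto simp: \<S>_def split: if_splits)
    qed
    show "disjnt (closed_segment (p u) (p v)) (convex hull S)"
      if uv: "u \<in> A \<union> B" "v \<in> A \<union> B" "u \<noteq> v" "{u, v} \<in> E" and S: "S \<in> \<S>" for u v S
    proof -
      have AA: ?thesis if "u \<in> A" "v \<in> A"
      proof -
        \<comment> \<open>An edge inside \<open>A\<close> rules out independence, so
          \<open>mid A\<close> is not among the obstacles. Everything else lies strictly to the
          right of the line at 0, and the edge does not.\<close>
        have "clique A E" using A uv that by (auto simp: indep_def)
        have "disjnt (closed_segment (p u) (p v)) (convex hull S)"
        proof (rule disjnt_segment_hull[of "axis 1 1" _ 0])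
          fix s assume "s \<in> S"
          with S_cases[OF S] \<open>clique A E\<close>
          consider a b where "a \<in> A" "b \<in> B" "s = T (f a) (g b)"
            | a b where "a \<in> B" "b \<in> B" "s = midpoint (p a) (p b)"
            by (auto simp: SK_def mid_def)
          then show "0 < axis 1 1 \<bullet> s"
          proof cases
            case 1 then show ?thesis using T_strip N by (simp add: inner_axis')
          next
            case 2 then show ?thesis using R_ge[of "g a"] R_ge[of "g b"]
              by (simp add: inner_axis' midpoint_def pB)
          qed
        qed (use L_le that in \<open>simp_all add: inner_axis' pA\<close>)
        then show ?thesis .
      qed
      have BB: ?thesis if "u \<in> B" "v \<in> B"
      proof -
        have "clique B E" using B uv that by (auto simp: indep_def)
        have "disjnt (closed_segment (p u) (p v)) (convex hull S)"
        \<comment> \<open>The reversed normal describes the half-plane to the right of the line at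
          1.\<close>
        proof (rule disjnt_segment_hull[of "- axis 1 1" _ "-1"])
          fix s assume "s \<in> S"
          with S_cases[OF S] \<open>clique B E\<close>
          consider a b where "a \<in> A" "b \<in> B" "s = T (f a) (g b)"
            | a b where "a \<in> A" "b \<in> A" "s = midpoint (p a) (p b)"
            by (auto simp: SK_def mid_def)
          then show "-1 < - axis 1 1 \<bullet> s"
          proof cases
            case 1 then show ?thesis using T_strip N by (simp add: inner_axis')
          next
            case 2 then show ?thesis using L_le[of "f a"] L_le[of "f b"]
              by (simp add: inner_axis' midpoint_def pA)
          qed
        qed (use R_ge that in \<open>simp_all add: inner_axis' pB\<close>)
        then show ?thesis .
      qed
      have AB: "disjnt (closed_segment (p i) (p j)) (convex hull S)"
        if ij: "i \<in> A" "j \<in> B" "{i, j} \<in> E" for i j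
      proof -
        note Nij = N(1)[OF ij(1)] N(2)[OF ij(2)]
        consider k where "S = SK k" | "S = mid A" | "S = mid B" using S_cases[OF S] by blast
        then show ?thesis
        proof cases
          case 1
          obtain w c where w: "w \<bullet> L (f i) = c" "w \<bullet> R (g j) = c"
            "\<And>a b. \<lbrakk>a \<le> N; b \<le> N; f i + g j < a + b\<rbrakk> \<Longrightarrow> w \<bullet> T a b > c"
            "\<And>a b. \<lbrakk>a \<le> N; b \<le> N; a + b \<le> f i + g j; (a, b) \<noteq> (f i, g j)\<rbrakk> \<Longrightarrow> w \<bullet> T a b < c"
            using separate_T[OF Nij] by blast
          \<comment> \<open>The edge between \<open>i\<close> and \<open>j\<close> activates
            \<open>level\<close>, so \<open>k\<close> really is the level of every point in
            \<open>S\<close>. These points come from nonedges, so injectivity excludes the index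
            pair of the edge itself.\<close>
          have SK: "\<exists>a b. s = T (f a) (g b) \<and> f a \<le> N \<and> g b \<le> N \<and> f a + g b = k \<and> (f a, g b) \<noteq> (f i, g j)"
            if s: "s \<in> S" for s
          proof -
            obtain a b where ab: "a \<in> A" "b \<in> B" "{a, b} \<notin> E" "l a b = k" "s = T (f a) (g b)"
              using s 1 by (auto simp: SK_def)
            have "(f a, g b) \<noteq> (f i, g j)" using ab ij f g by (auto simp: inj_on_eq_iff)
            then show ?thesis using ab N level[OF ij ab(1,2)] by metis
          qed
          show ?thesis
          \<comment> \<open>Higher levels lie above the edge. The level of the edge is grouped with
            the lower ones: its other tangency points lie below, as on a parabola under its
            tangent.\<close>
          proof (cases "f i + g j < k")
            case True
            show ?thesis
              by (rule disjnt_segment_hull[of w _ c]) (use w True SK ij in \<open>force simp: pA pB\<close>)+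
          next
            case False
            show ?thesis
              by (rule disjnt_segment_hull[of "-w" _ "-c"]) (use w False SK ij in \<open>force simp: pA pB\<close>)+
          qed
        next
          case 2
          obtain w c where w: "w \<bullet> L (f i) \<le> c" "w \<bullet> R (g j) \<le> c"
            "\<And>u v. u \<noteq> v \<Longrightarrow> w \<bullet> midpoint (L u) (L v) > c" using separate_L[OF Nij] by blast
          show ?thesis
            by (rule disjnt_segment_hull[of w _ c])
              (use w 2 ij f in \<open>auto simp: pA pB mid_def inj_on_eq_iff\<close>)
        next
          case 3
          obtain w c where w: "w \<bullet> L (f i) \<le> c" "w \<bullet> R (g j) \<le> c"
            "\<And>u v. u \<noteq> v \<Longrightarrow> w \<bullet> midpoint (R u) (R v) > c" using separate_R[OF Nij] by blast
          show ?thesis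
            by (rule disjnt_segment_hull[of w _ c])
              (use w 3 ij g in \<open>auto simp: pA pB mid_def inj_on_eq_iff\<close>)
        qed
      qed
      show ?thesis
        using AA BB AB[of u v] AB[of v u] uv by (auto simp: insert_commute closed_segment_commute)
    qed
    show "\<exists>S\<in>\<S>. \<not> disjnt (closed_segment (p u) (p v)) (convex hull S)"
      if uv: "u \<in> A \<union> B" "v \<in> A \<union> B" "u \<noteq> v" "{u, v} \<notin> E" for u v
    proof -
      have hit: ?thesis if "x \<in> closed_segment (p u) (p v)" "x \<in> S" "S \<in> \<S>" for x S
        using that hull_inc[of x S convex] by (auto simp: disjnt_iff)
      have same_part: ?thesis if "u \<in> X" "v \<in> X" "X = A \<or> X = B" for X
      proof -
        have "\<not> clique X E" using uv that by (auto simp: clique_def)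
        then have "mid X \<in> \<S>" using that by (auto simp: \<S>_def)
        moreover have "midpoint (p u) (p v) \<in> mid X" using uv that by (auto simp: mid_def)
        ultimately show ?thesis using hit[OF midpoint_in_closed_segment] by blast
      qed
      have cross: "\<exists>S\<in>\<S>. \<exists>x\<in>S. x \<in> closed_segment (p i) (p j)" if "i \<in> A" "j \<in> B" "{i, j} \<notin> E" for i j
      proof -
        have "SK (l i j) \<in> \<S>" using that by (auto simp: \<S>_def K_def)
        moreover have "T (f i) (g j) \<in> SK (l i j)" using that by (auto simp: SK_def)
        ultimately show ?thesis using T_segment[of "f i" "g j"] that by (auto simp: pA pB)
      qed
      show ?thesis
        using same_part[of A] same_part[of B] cross[of u v] cross[of v u] hit uv
        by (auto simp: insert_commute closed_segment_commute)
    qed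
  qed
  also have "card \<S> \<le> card K + (if clique A E then 0 else 1) + (if clique B E then 0 else 1)"
  proof -
    have "card \<S> \<le> card (SK ` K) + card (if clique A E then {} else {mid A}) + card (if clique B E then {} else {mid B})"
      unfolding \<S>_def by (meson add_mono card_Un_le le_refl le_trans)
    also have "\<dots> \<le> card K + (if clique A E then 0 else 1) + (if clique B E then 0 else 1)"
      using card_image_le[OF \<open>finite K\<close>, of SK] by auto
    finally show ?thesis .
  qed
  finally show ?thesis by (simp add: K_def)
qed

section \<open>Counting the occupied levels\<close>

text \<open>Needed to move chosen edges to the lowest and highest levels. Two transpositions adjust
  an arbitrary enumeration.\<close>

lemma ex_enumeration_endpoints:
  assumes "finite A" "x \<in> A" "y \<in> A"
  obtains f :: "'a \<Rightarrow> nat" where "bij_betw f A {..<card A}" "f x = 0" "x \<noteq> y \<Longrightarrow> f y = card A - 1"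
proof -
  obtain f where f: "bij_betw f A {..<card A}"
    using ex_bij_betw_finite_nat[OF assms(1)] by (auto simp: atLeast0LessThan)
  have "card A > 0" using assms by (auto simp: card_gt_0_iff)
  have swap: "bij_betw (Transposition.transpose i j \<circ> h) A {..<card A}"
    if h: "bij_betw h A {..<card A}" and "i < card A" "j < card A" for h :: "'a \<Rightarrow> nat" and i j
    using that by (intro bij_betw_trans[OF h]) simp
  define g where "g = Transposition.transpose (f x) 0 \<circ> f"
  have "f x < card A" using bij_betwE[OF f] assms by auto
  then have g: "bij_betw g A {..<card A}" "g x = 0"
    using swap[OF f] \<open>card A > 0\<close> by (simp_all add: g_def)
  show thesis
  proof (cases "x = y")
    case False
    \<comment> \<open>This makes both values swapped by the second transposition nonzero, so
      \<open>x\<close> stays at 0.\<close>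
    then have "g y \<noteq> 0" using g assms by (metis bij_betw_def inj_on_eq_iff)
    moreover have "g y < card A" using bij_betwE[OF g(1)] assms by auto
    ultimately show thesis
      using g by (intro that[of "Transposition.transpose (g y) (card A - 1) \<circ> g"] swap)
        (auto simp: Transposition.transpose_def)
  next
    case True
    then show thesis using that[OF g] by simp
  qed
qed

text \<open>Only levels from 0 to \<open>card A + card B - 2\<close> occur, and cliques need no
  obstacle of their own.\<close>

lemma obstacles_two_cliques:
  assumes fin: "finite A" "finite B" and disj: "A \<inter> B = {}"
    and clique: "clique A E" "clique B E"
  shows "convex_obstacle_number (A \<union> B) E \<le> enat (card (A \<union> B) - 1)"
proof -
  obtain f :: "'a \<Rightarrow> nat" where f: "bij_betw f A {..<card A}"
    using ex_bij_betw_finite_nat[OF fin(1)] by (auto simp: atLeast0LessThan)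
  obtain g :: "'a \<Rightarrow> nat" where g: "bij_betw g B {..<card B}"
    using ex_bij_betw_finite_nat[OF fin(2)] by (auto simp: atLeast0LessThan)
  let ?K = "{f a + g b | a b. a \<in> A \<and> b \<in> B \<and> {a, b} \<notin> E}"
  have "f a + g b < card A + card B - 1" if "a \<in> A" "b \<in> B" for a b
  proof -
    have "f a < card A" "g b < card B" using bij_betwE[OF f] bij_betwE[OF g] that by auto
    then show ?thesis by linarith
  qed
  then have sub: "?K \<subseteq> {..<card A + card B - 1}" by auto
  have K: "card ?K \<le> card A + card B - 1"
    using card_mono[OF finite_lessThan sub] by (simp only: card_lessThan)
  have "convex_obstacle_number (A \<union> B) E \<le>
      enat (card ?K + (if clique A E then 0 else 1) + (if clique B E then 0 else 1))"
    by (rule convex_obstacle_number_two_parts[where l = "\<lambda>a b. f a + g b", OF fin disj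
          bij_betw_imp_inj_on[OF f] bij_betw_imp_inj_on[OF g] disjI2[OF clique(1)] disjI2[OF clique(2)] refl])
  also have "\<dots> \<le> enat (card (A \<union> B) - 1)"
    using K clique card_Un_disjoint[OF fin disj] by simp
  finally show ?thesis .
qed

text \<open>The obstacle for the chords of \<open>A\<close> is paid for by an edge that occupies
  level 0 alone, or by merging all levels if no edge runs between the parts.\<close>

lemma obstacles_independent_clique:
  assumes fin: "finite A" "finite B" and disj: "A \<inter> B = {}"
    and AB: "indep A E" "clique B E"
  shows "convex_obstacle_number (A \<union> B) E \<le> enat (card (A \<union> B) - 1)"
proof (cases "clique A E")
  case True
  then show ?thesis using obstacles_two_cliques assms by blast
next
  case not_clique: False
  then obtain u v where "u \<in> A" "v \<in> A" "u \<noteq> v" by (auto simp: clique_def)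
  then have A2: "card A \<ge> 2" using fin(1) card_le_Suc0_iff_eq[of A] by fastforce
  have card: "card (A \<union> B) = card A + card B" using fin disj by (rule card_Un_disjoint)
  show ?thesis
  proof (cases "\<exists>a\<in>A. \<exists>b\<in>B. {a, b} \<in> E")
    case True
    then obtain a0 b0 where e: "a0 \<in> A" "b0 \<in> B" "{a0, b0} \<in> E" by blast
    obtain f where f: "bij_betw f A {..<card A}" "f a0 = 0"
      using ex_enumeration_endpoints[OF fin(1) e(1,1)] by metis
    obtain g where g: "bij_betw g B {..<card B}" "g b0 = 0"
      using ex_enumeration_endpoints[OF fin(2) e(2,2)] by metis
    let ?K = "{f a + g b | a b. a \<in> A \<and> b \<in> B \<and> {a, b} \<notin> E}"
    have "f a + g b \<in> {1..card A + card B - 2}" if "a \<in> A" "b \<in> B" "{a, b} \<notin> E" for a b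
    proof -
      have "f a < card A" "g b < card B" using bij_betwE[OF f(1)] bij_betwE[OF g(1)] that by auto
      moreover have "f a \<noteq> f a0 \<or> g b \<noteq> g b0"
        using that e f(1) g(1) by (metis bij_betw_def inj_on_eq_iff)
      ultimately show ?thesis unfolding atLeastAtMost_iff f(2) g(2) by linarith
    qed
    then have sub: "?K \<subseteq> {1..card A + card B - 2}" by blast
    have K: "card ?K \<le> card A + card B - 2"
      using card_mono[OF finite_atLeastAtMost sub] by (simp only: card_atLeastAtMost diff_Suc_1)
    have "convex_obstacle_number (A \<union> B) E \<le>
        enat (card ?K + (if clique A E then 0 else 1) + (if clique B E then 0 else 1))"
      by (rule convex_obstacle_number_two_parts[where l = "\<lambda>a b. f a + g b", OF fin disj
            bij_betw_imp_inj_on[OF f(1)] bij_betw_imp_inj_on[OF g(1)] disjI1[OF AB(1)] disjI2[OF AB(2)] refl])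
    also have "\<dots> \<le> enat (card (A \<union> B) - 1)" using K AB(2) not_clique A2 card by simp
    finally show ?thesis .
  next
    case no_edge: False
    obtain f :: "'a \<Rightarrow> nat" where f: "inj_on f A" using finite_imp_inj_to_nat_seg[OF fin(1)] by blast
    obtain g :: "'a \<Rightarrow> nat" where g: "inj_on g B" using finite_imp_inj_to_nat_seg[OF fin(2)] by blast
    let ?K = "{0 :: nat | a b. a \<in> A \<and> b \<in> B \<and> {a, b} \<notin> E}"
    \<comment> \<open>Bounding by \<open>card B\<close> rather than 1 also covers empty
      \<open>B\<close>, where no such obstacle exists. With \<open>card A\<close> at least 2 there
      is room for the obstacle of \<open>A\<close>.\<close>
    have K: "card ?K \<le> card B"
    proof (cases "B = {}")
      case False
      have "card ?K \<le> card {0::nat}" by (rule card_mono) auto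
      also have "\<dots> \<le> card B" using False fin(2) by (simp add: Suc_le_eq card_gt_0_iff)
      finally show ?thesis .
    qed auto
    have "convex_obstacle_number (A \<union> B) E \<le>
        enat (card ?K + (if clique A E then 0 else 1) + (if clique B E then 0 else 1))"
      by (rule convex_obstacle_number_two_parts[where l = "\<lambda>_ _. 0", OF fin disj f g
            disjI1[OF AB(1)] disjI2[OF AB(2)]]) (use no_edge in blast)
    also have "\<dots> \<le> enat (card (A \<union> B) - 1)" using K AB(2) not_clique A2 card by simp
    finally show ?thesis .
  qed
qed

text \<open>Two disjoint edges between the parts clear the lowest and the highest level, which pays
  for both chord obstacles. Otherwise these edges pairwise meet and, there being no triangles, form
  a star or are absent; the graph is then split.\<close>

lemma obstacles_two_independent:
  assumes fin: "finite A" "finite B" and disj: "A \<inter> B = {}"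
    and AB: "indep A E" "indep B E"
  shows "convex_obstacle_number (A \<union> B) E \<le> enat (card (A \<union> B) - 1)"
proof (cases "\<exists>a0\<in>A. \<exists>b0\<in>B. \<exists>a1\<in>A. \<exists>b1\<in>B. a0 \<noteq> a1 \<and> b0 \<noteq> b1 \<and> {a0, b0} \<in> E \<and> {a1, b1} \<in> E")
  case True
  then obtain a0 b0 a1 b1 where e: "a0 \<in> A" "b0 \<in> B" "a1 \<in> A" "b1 \<in> B" "a0 \<noteq> a1" "b0 \<noteq> b1"
    "{a0, b0} \<in> E" "{a1, b1} \<in> E" by blast
  have card: "card (A \<union> B) = card A + card B" using fin disj by (rule card_Un_disjoint)
  have "card A \<ge> 2" "card B \<ge> 2" using e fin card_le_Suc0_iff_eq[of A] card_le_Suc0_iff_eq[of B] by fastforce+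
  obtain f where f: "bij_betw f A {..<card A}" "f a0 = 0" "f a1 = card A - 1"
    using ex_enumeration_endpoints[OF fin(1) e(1,3)] e(5) by metis
  obtain g where g: "bij_betw g B {..<card B}" "g b0 = 0" "g b1 = card B - 1"
    using ex_enumeration_endpoints[OF fin(2) e(2,4)] e(6) by metis
  let ?K = "{f a + g b | a b. a \<in> A \<and> b \<in> B \<and> {a, b} \<notin> E}"
  have "f a + g b \<in> {1..card A + card B - 3}" if "a \<in> A" "b \<in> B" "{a, b} \<notin> E" for a b
  proof -
    have "f a < card A" "g b < card B" using bij_betwE[OF f(1)] bij_betwE[OF g(1)] that by auto
    moreover have "f a \<noteq> f a0 \<or> g b \<noteq> g b0" "f a \<noteq> f a1 \<or> g b \<noteq> g b1"
      using that e f(1) g(1) by (metis bij_betw_def inj_on_eq_iff)+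
    ultimately show ?thesis unfolding atLeastAtMost_iff f(2,3) g(2,3) by linarith
  qed
  then have sub: "?K \<subseteq> {1..card A + card B - 3}" by blast
  have "card ?K \<le> card A + card B - 3"
    using card_mono[OF finite_atLeastAtMost sub] by (simp only: card_atLeastAtMost diff_Suc_1)
  then have le: "card ?K + 1 + 1 \<le> card A + card B - 1" using \<open>card A \<ge> 2\<close> \<open>card B \<ge> 2\<close> by linarith
  have "convex_obstacle_number (A \<union> B) E \<le>
      enat (card ?K + (if clique A E then 0 else 1) + (if clique B E then 0 else 1))"
    by (rule convex_obstacle_number_two_parts[where l = "\<lambda>a b. f a + g b", OF fin disj
          bij_betw_imp_inj_on[OF f(1)] bij_betw_imp_inj_on[OF g(1)] disjI1[OF AB(1)] disjI1[OF AB(2)] refl])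
  also have "\<dots> \<le> enat (card (A \<union> B) - 1)" using le card by simp
  finally show ?thesis .
next
  case False
  then have meet: "a = a' \<or> b = b'"
    if "a \<in> A" "b \<in> B" "{a, b} \<in> E" "a' \<in> A" "b' \<in> B" "{a', b'} \<in> E" for a b a' b'
    using that by blast
  \<comment> \<open>A set \<open>C\<close> that covers all edges between the parts leaves an
    independent set; it will be the star centre or empty.\<close>
  have indep: "indep (A \<union> B - C) E"
    if C: "\<And>a b. \<lbrakk>a \<in> A; b \<in> B; {a, b} \<in> E\<rbrakk> \<Longrightarrow> a \<in> C \<or> b \<in> C" for C
    unfolding indep_def
  proof (intro ballI impI notI)
    fix u v assume uv: "u \<in> A \<union> B - C" "v \<in> A \<union> B - C" "u \<noteq> v" "{u, v} \<in> E"
    then have "{v, u} \<in> E" by (simp add: insert_commute)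
    moreover have "u \<in> A \<and> v \<in> A \<or> u \<in> B \<and> v \<in> B \<or> u \<in> A \<and> v \<in> B \<or> u \<in> B \<and> v \<in> A"
      using uv by blast
    ultimately show False
      using uv AB C[of u v] C[of v u] unfolding indep_def by blast
  qed
  have "\<exists>C. C \<subseteq> A \<union> B \<and> clique C E \<and> indep (A \<union> B - C) E"
  proof (cases "\<exists>a\<in>A. \<exists>b\<in>B. {a, b} \<in> E")
    case True
    then obtain a0 b0 where e: "a0 \<in> A" "b0 \<in> B" "{a0, b0} \<in> E" by blast
    have "\<exists>c\<in>A \<union> B. \<forall>a\<in>A. \<forall>b\<in>B. {a, b} \<in> E \<longrightarrow> a = c \<or> b = c"
    proof (cases "\<forall>a\<in>A. \<forall>b\<in>B. {a, b} \<in> E \<longrightarrow> a = a0")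
      case True
      then show ?thesis using e(1) by blast
    next
      case False
      then obtain a b where ab: "a \<in> A" "b \<in> B" "{a, b} \<in> E" "a \<noteq> a0" by blast
      then have "b = b0" using meet[OF ab(1-3) e] by simp
      \<comment> \<open>An edge avoiding \<open>b0\<close> would have to meet two edges at
        \<open>b0\<close> in their distinct ends \<open>a\<close> and \<open>a0\<close>.\<close>
      then have "b' = b0" if "a' \<in> A" "b' \<in> B" "{a', b'} \<in> E" for a' b'
        using meet[OF that ab(1-3)] meet[OF that e] ab(4) by auto
      then show ?thesis using e(2) by blast
    qed
    then obtain c where c: "c \<in> A \<union> B" "\<And>a b. \<lbrakk>a \<in> A; b \<in> B; {a, b} \<in> E\<rbrakk> \<Longrightarrow> a = c \<or> b = c"
      by blast
    then show ?thesis using indep[of "{c}"] by (intro exI[of _ "{c}"]) (simp add: clique_def)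
  next
    case False
    then show ?thesis using indep[of "{}"] by (intro exI[of _ "{}"]) (auto simp: clique_def)
  qed
  then obtain C where C: "C \<subseteq> A \<union> B" "clique C E" "indep (A \<union> B - C) E" by blast
  then have "finite C" "(A \<union> B - C) \<union> C = A \<union> B" using fin finite_subset[of C "A \<union> B"] by auto
  moreover have "finite (A \<union> B - C)" "(A \<union> B - C) \<inter> C = {}" using fin by auto
  ultimately show ?thesis using obstacles_independent_clique[of "A \<union> B - C" C E] C by simp
qed

text \<open>Complementation makes the independent part \<open>A\<close> a clique, so two independent
  parts arise only for the graph itself. If \<open>B\<close> was a clique, the complement is handled
  with the two parts exchanged.\<close>

theorem theorem1:
  fixes V :: "'a set" and E :: "'a set set"
  assumes "simple_graph V E" and "V \<noteq> {}"
    and "bipartite_graph V E \<or> split_graph V E"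
  shows "convex_obstacle_number V E \<le> enat (card V - 1) \<and>
         convex_obstacle_number V (complement_edges V E) \<le> enat (card V - 1)"
proof -
  obtain A B where AB: "A \<union> B = V" "A \<inter> B = {}" "indep A E" "indep B E \<or> clique B E"
    using assms(3) unfolding bipartite_graph_def split_graph_def by blast
  let ?E = "complement_edges V E"
  have "finite V" using assms(1) by (simp add: simple_graph_def)
  then have fin: "finite A" "finite B" using AB(1) by auto
  have E': "{u, v} \<in> ?E \<longleftrightarrow> {u, v} \<notin> E" if "u \<in> V" "v \<in> V" "u \<noteq> v" for u v
    using that by (auto simp: complement_edges_def nsets_def)
  have "clique A ?E" "indep B ?E \<or> clique B ?E"
    using AB(1,3,4) E' unfolding clique_def indep_def by blast+
  then have "convex_obstacle_number V ?E \<le> enat (card V - 1)"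
    using obstacles_two_cliques[OF fin AB(2), of ?E]
      obstacles_independent_clique[of B A ?E] fin AB(1,2) by (metis Int_commute Un_commute)
  moreover have "convex_obstacle_number V E \<le> enat (card V - 1)"
    using obstacles_independent_clique[OF fin AB(2,3)]
      obstacles_two_independent[OF fin AB(2,3)] AB(1,4) by blast
  ultimately show ?thesis by blast
qed

end
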